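(* Let $t\ge 2$, $p\ge 1$ be integers, let $G=K_{p,\ldots,p}$ be the complete $t$-partite graph with all parts of size $p$, put $d=p(t-1)$, and let $\phi$ be a symmetric real-valued degree weight with $\phi(d,d)\ne 0$. Then all eigenvalues of $\dot A(G)$ are integers if and only if $p\,\phi(d,d)\in\mathbb Z$.
   Context: For a symmetric function $\phi:\mathbb R_{>0}\times\mathbb R_{>0}\to\mathbb R$ and a finite simple graph $G$ with vertices $v_1,\dots,v_n$ of degrees $d_1,\dots,d_n$, the degree-based weighted adjacency matrix $\dot A(G)$ is the $n\times n$ real symmetric matrix whose $(i,j)$ entry is $\phi(d_i,d_j)$ if $v_i$ and $v_j$ are adjacent, and $0$ otherwise. *)

theory Defs
  imports "HOL-Library.Disjoint_Sets" "Graph_Theory.Digraph" "Jordan_Normal_Form.Char_Poly"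
begin

text \<open>
  A finite simple graph is a symmetric digraph in the sense of the locale \<open>graph\<close>: finite, no
  loops, no parallel arcs. Each edge is a pair of opposite arcs, so the degree of a vertex is its
  out-degree.
\<close>

text \<open>
  The complete \<open>t\<close>-partite graph with all parts of size \<open>p\<close>, up to isomorphism (for \<open>p > 0\<close>:
  the parts of a \<open>partition_on\<close> are nonempty).
\<close>

definition complete_equipartite_digraph :: "nat \<Rightarrow> nat \<Rightarrow> ('a, 'b) pre_digraph \<Rightarrow> bool" where
  "complete_equipartite_digraph t p G \<longleftrightarrow> graph G \<and>
     (\<exists>P. partition_on (verts G) P \<and> card P = t \<and> (\<forall>U\<in>P. card U = p) \<and>
          arcs_ends G = {(u, v). \<exists>U\<in>P. \<exists>V\<in>P. U \<noteq> V \<and> u \<in> U \<and> v \<in> V})"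

text \<open>
  A degree weight is a symmetric real function on pairs of positive reals; its values at
  arguments that are not both positive are unconstrained and play no role.
\<close>

definition symmetric_weight :: "(real \<Rightarrow> real \<Rightarrow> real) \<Rightarrow> bool" where
  "symmetric_weight \<phi> \<longleftrightarrow> (\<forall>x>0. \<forall>y>0. \<phi> x y = \<phi> y x)"

definition vertex_enum :: "('a, 'b) pre_digraph \<Rightarrow> 'a list \<Rightarrow> bool" where
  "vertex_enum G vs \<longleftrightarrow> distinct vs \<and> set vs = verts G"

definition weighted_adj_mat ::
    "(real \<Rightarrow> real \<Rightarrow> real) \<Rightarrow> ('a, 'b) pre_digraph \<Rightarrow> 'a list \<Rightarrow> real mat" where
  "weighted_adj_mat \<phi> G vs = mat (length vs) (length vs) (\<lambda>(i, j).
     if vs ! i \<rightarrow>\<^bsub>G\<^esub> vs ! j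
     then \<phi> (real (out_degree G (vs ! i))) (real (out_degree G (vs ! j)))
     else 0)"

end

theory Submission
  imports Defs
begin

text \<open>
  The graph is regular of degree \<open>d\<close>, so its weighted adjacency matrix is the ordinary one times
  \<open>c = \<phi> d d\<close>. Reading vectors as functions \<open>f\<close> on the vertices, the matrix sends \<open>f\<close> to the
  function that on a part \<open>U\<close> is constantly \<open>c\<close> times the sum of \<open>f\<close> outside \<open>U\<close>.

  Let \<open>f\<close> be an eigenfunction for \<open>k\<close>, with sum \<open>S\<^sub>U\<close> on each part and total sum \<open>S\<close>. Adding the
  eigenvalue equation over \<open>U\<close> yields \<open>(k + p c) S\<^sub>U = p c S\<close>. If \<open>k \<noteq> -p c\<close>, all the \<open>S\<^sub>U\<close> are
  equal: either they are all \<open>0\<close>, whence \<open>k f = 0\<close> and \<open>k = 0\<close>, or \<open>k = p c (t - 1)\<close>. So every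
  eigenvalue is an integer multiple of \<open>p c\<close>, which settles one direction.

  Conversely \<open>-p c\<close> really occurs: as \<open>t \<ge> 2\<close>, there is the function that is \<open>1\<close> on one part, \<open>-1\<close>
  on another and \<open>0\<close> elsewhere.
\<close>

text \<open>
  Passing from vectors to functions on the vertices removes the enumeration from all later sums.
\<close>

lemma eigenvalue_weighted_adj_mat_iff:
  assumes "vertex_enum G vs"
  shows "eigenvalue (weighted_adj_mat \<phi> G vs) k \<longleftrightarrow>
    (\<exists>f. (\<exists>u\<in>verts G. f u \<noteq> 0) \<and>
      (\<forall>u\<in>verts G. (\<Sum>w\<in>verts G. (if u \<rightarrow>\<^bsub>G\<^esub> w
          then \<phi> (real (out_degree G u)) (real (out_degree G w)) else 0) * f w) = k * f u))"
    (is "_ \<longleftrightarrow> (\<exists>f. ?nonzero f \<and> (\<forall>u\<in>verts G. (\<Sum>w\<in>verts G. ?a u w * f w) = k * f u))")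
proof -
  let ?A = "weighted_adj_mat \<phi> G vs" and ?n = "length vs"
  have bij: "bij_betw (\<lambda>i. vs ! i) {0..<?n} (verts G)"
    using assms bij_betw_nth[of vs "{0..<?n}" "verts G"]
    by (auto simp: vertex_enum_def lessThan_atLeast0)
  have dim: "dim_row ?A = ?n" "dim_col ?A = ?n"
    by (simp_all add: weighted_adj_mat_def)
  have all_verts: "(\<forall>u\<in>verts G. Q u) \<longleftrightarrow> (\<forall>i<?n. Q (vs ! i))" for Q
    using assms unfolding vertex_enum_def by (metis in_set_conv_nth)
  have mult: "(?A *\<^sub>v x) $ i = (\<Sum>w\<in>verts G. ?a (vs ! i) w * f w)"
    if "x = vec ?n (\<lambda>i. f (vs ! i))" "i < ?n" for x f i
    using that dim
    by (simp add: scalar_prod_def weighted_adj_mat_def flip: sum.reindex_bij_betw[OF bij])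
  have key: "eigenvector ?A x k \<longleftrightarrow>
      ?nonzero f \<and> (\<forall>u\<in>verts G. (\<Sum>w\<in>verts G. ?a u w * f w) = k * f u)"
    if x: "x = vec ?n (\<lambda>i. f (vs ! i))" for x f
  proof -
    have "x \<noteq> 0\<^sub>v ?n \<longleftrightarrow> ?nonzero f"
      using all_verts[of "\<lambda>u. f u = 0"] x by (auto simp: vec_eq_iff)
    moreover have "?A *\<^sub>v x = k \<cdot>\<^sub>v x \<longleftrightarrow> (\<forall>i<?n. (?A *\<^sub>v x) $ i = k * f (vs ! i))"
      using x dim by (auto simp: vec_eq_iff)
    moreover have "\<dots> \<longleftrightarrow> (\<forall>u\<in>verts G. (\<Sum>w\<in>verts G. ?a u w * f w) = k * f u)"
      using mult[OF x] all_verts by simp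
    ultimately show ?thesis
      using x dim by (simp add: eigenvector_def)
  qed
  have vec_of_fun: "\<exists>f. x = vec ?n (\<lambda>i. f (vs ! i))" if x: "eigenvector ?A x k" for x
  proof -
    let ?idx = "the_inv_into {0..<?n} (\<lambda>i. vs ! i)"
    have "?idx (vs ! i) = i" if "i < ?n" for i
      using that the_inv_into_f_f[OF bij_betw_imp_inj_on[OF bij], of i] by simp
    moreover have "dim_vec x = ?n"
      using x dim unfolding eigenvector_def by auto
    ultimately have "x = vec ?n (\<lambda>i. x $ ?idx (vs ! i))"
      by (intro eq_vecI) auto
    then show ?thesis
      by (rule exI[of _ "\<lambda>u. x $ ?idx u"])
  qed
  have "eigenvalue ?A k \<longleftrightarrow> (\<exists>f. eigenvector ?A (vec ?n (\<lambda>i. f (vs ! i))) k)"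
  proof
    assume "eigenvalue ?A k"
    then obtain x where x: "eigenvector ?A x k" by (auto simp: eigenvalue_def)
    obtain f where "x = vec ?n (\<lambda>i. f (vs ! i))" using vec_of_fun[OF x] by blast
    with x show "\<exists>f. eigenvector ?A (vec ?n (\<lambda>i. f (vs ! i))) k" by (intro exI) simp
  qed (auto simp only: eigenvalue_def)
  then show ?thesis
    unfolding key[OF refl] .
qed

text \<open>In a simple graph an arc is determined by its ends, so arcs can be counted as neighbours.\<close>

lemma (in digraph) out_degree_eq_card_neighbours:
  "out_degree G u = card {w. u \<rightarrow>\<^bsub>G\<^esub> w}"
proof -
  have "inj_on (head G) (out_arcs G u)"
    by (auto intro!: inj_onI no_multi_arcs simp: arc_to_ends_def)
  moreover have "head G ` out_arcs G u = {w. u \<rightarrow>\<^bsub>G\<^esub> w}"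
    by (force simp: arcs_ends_def arc_to_ends_def out_arcs_def)
  ultimately show ?thesis
    unfolding out_degree_def by (metis card_image)
qed

theorem corollary2p12:
  fixes t p d :: nat
    and G :: "('a, 'b) pre_digraph"
    and vs :: "'a list"
    and \<phi> :: "real \<Rightarrow> real \<Rightarrow> real"
  assumes "t \<ge> 2" and "p \<ge> 1"
    and "complete_equipartite_digraph t p G"
    and "vertex_enum G vs"
    and "d = p * (t - 1)"
    and "symmetric_weight \<phi>"
    and "\<phi> (real d) (real d) \<noteq> 0"
  shows "(\<forall>k. eigenvalue (weighted_adj_mat \<phi> G vs) k \<longrightarrow> k \<in> \<int>)
    \<longleftrightarrow> real p * \<phi> (real d) (real d) \<in> \<int>"
proof -
  define c where "c = \<phi> (real d) (real d)"
  obtain P where "graph G" and part: "partition_on (verts G) P" and cardP: "card P = t"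
    and cardU: "\<And>U. U \<in> P \<Longrightarrow> card U = p"
    and ends: "arcs_ends G = {(u, v). \<exists>U\<in>P. \<exists>V\<in>P. U \<noteq> V \<and> u \<in> U \<and> v \<in> V}"
    using assms(3) unfolding complete_equipartite_digraph_def by blast
  interpret graph G by fact
  have disjoint: "U \<inter> V = {}" if "U \<in> P" "V \<in> P" "U \<noteq> V" for U V
    using that part by (auto simp: partition_on_def disjoint_def)
  then have disj: "U = V" if "u \<in> U" "u \<in> V" "U \<in> P" "V \<in> P" for u U V
    using that by blast
  have verts_eq: "verts G = \<Union>P"
    using part by (simp add: partition_on_def)
  have in_verts: "u \<in> verts G \<longleftrightarrow> (\<exists>U\<in>P. u \<in> U)" for u
    by (simp add: verts_eq)
  have part_subset: "U \<subseteq> verts G" if "U \<in> P" for U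
    using that in_verts by blast
  have finP: "finite P" "\<And>U. U \<in> P \<Longrightarrow> finite U"
    using assms(1,2) cardP cardU by (metis card.infinite not_numeral_le_zero not_one_le_zero)+
  have total: "sum f (verts G) = (\<Sum>U\<in>P. sum f U)" for f :: "'a \<Rightarrow> real"
    unfolding verts_eq using finP disjoint by (simp add: sum.Union_disjoint)
  have card_verts: "card (verts G) = t * p"
    unfolding verts_eq using finP disjoint cardU cardP
    by (simp add: card_Union_disjoint pairwise_def disjnt_def)
  have nbrs: "{w. u \<rightarrow>\<^bsub>G\<^esub> w} = verts G - U" if "u \<in> U" "U \<in> P" for u U
  proof (rule Set.set_eqI)
    fix w
    have "u \<rightarrow>\<^bsub>G\<^esub> w \<longleftrightarrow> (\<exists>V\<in>P. U \<noteq> V \<and> w \<in> V)"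
      unfolding ends mem_Collect_eq case_prod_conv using that disj by metis
    also have "\<dots> \<longleftrightarrow> w \<in> verts G - U"
      unfolding verts_eq using that(2) disj by (metis DiffE DiffI UnionE UnionI)
    finally show "w \<in> {w. u \<rightarrow>\<^bsub>G\<^esub> w} \<longleftrightarrow> w \<in> verts G - U" by simp
  qed
  have deg: "out_degree G u = d" if u: "u \<in> verts G" for u
  proof -
    obtain U where U: "u \<in> U" "U \<in> P" using u in_verts by blast
    have "out_degree G u = card (verts G) - card U"
      unfolding out_degree_eq_card_neighbours nbrs[OF U] by (intro card_Diff_subset finP(2) part_subset U)
    then show ?thesis
      unfolding cardU[OF U(2)] card_verts assms(5) by (cases t) (auto simp: mult.commute)
  qed
  have row: "(\<Sum>w\<in>verts G. (if u \<rightarrow>\<^bsub>G\<^esub> w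
          then \<phi> (real (out_degree G u)) (real (out_degree G w)) else 0) * f w)
      = c * (sum f (verts G) - sum f U)" (is "?row = _") if "u \<in> U" "U \<in> P" for f u U
  proof -
    have u: "u \<in> verts G" using that in_verts by blast
    have "?row = (\<Sum>w\<in>verts G. if w \<in> verts G - U then c * f w else 0)"
    proof (rule sum.cong[OF refl])
      fix w assume w: "w \<in> verts G"
      have "u \<rightarrow>\<^bsub>G\<^esub> w \<longleftrightarrow> w \<in> verts G - U"
        using nbrs[OF that] by blast
      then show "(if u \<rightarrow>\<^bsub>G\<^esub> w
          then \<phi> (real (out_degree G u)) (real (out_degree G w)) else 0) * f w
        = (if w \<in> verts G - U then c * f w else 0)"
        by (simp add: deg[OF u] deg[OF w] c_def)
    qed
    also have "\<dots> = c * sum f (verts G - U)"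
      by (simp add: sum_distrib_left sum.If_cases Diff_eq Compl_eq)
    also have "\<dots> = c * (sum f (verts G) - sum f U)"
      using part_subset[OF that(2)] by (simp add: sum_diff)
    finally show ?thesis .
  qed
  have eig: "eigenvalue (weighted_adj_mat \<phi> G vs) k \<longleftrightarrow>
    (\<exists>f. (\<exists>u\<in>verts G. f u \<noteq> 0) \<and>
      (\<forall>U\<in>P. \<forall>u\<in>U. c * (sum f (verts G) - sum f U) = k * f u))" for k
    unfolding eigenvalue_weighted_adj_mat_iff[OF assms(4)]
  proof (intro ex_cong1 conj_cong refl)
    fix f :: "'a \<Rightarrow> real"
    show "(\<forall>u\<in>verts G. (\<Sum>w\<in>verts G. (if u \<rightarrow>\<^bsub>G\<^esub> w
          then \<phi> (real (out_degree G u)) (real (out_degree G w)) else 0) * f w) = k * f u)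
      \<longleftrightarrow> (\<forall>U\<in>P. \<forall>u\<in>U. c * (sum f (verts G) - sum f U) = k * f u)" (is "?L \<longleftrightarrow> ?R")
    proof -
      have "?L \<longleftrightarrow> (\<forall>U\<in>P. \<forall>u\<in>U. (\<Sum>w\<in>verts G. (if u \<rightarrow>\<^bsub>G\<^esub> w
          then \<phi> (real (out_degree G u)) (real (out_degree G w)) else 0) * f w) = k * f u)"
        by (auto simp: in_verts)
      also have "\<dots> \<longleftrightarrow> ?R"
        by (intro ball_cong refl) (simp only: row)
      finally show ?thesis .
    qed
  qed
  have "eigenvalue (weighted_adj_mat \<phi> G vs) (- (real p * c))"
  proof -
    obtain U V where UV: "U \<in> P" "V \<in> P" "U \<noteq> V"
      using assms(1) cardP by (metis card_le_Suc0_iff_eq finP(1) not_less_eq_eq numeral_2_eq_2)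
    define f :: "'a \<Rightarrow> real" where "f = (\<lambda>u. of_bool (u \<in> U) - of_bool (u \<in> V))"
    have f_const: "f w = (if W = U then 1 else if W = V then -1 else 0)"
      if "w \<in> W" "W \<in> P" for w W
    proof -
      have "w \<in> U \<longleftrightarrow> W = U" "w \<in> V \<longleftrightarrow> W = V"
        using that UV disj by metis+
      then show ?thesis
        using UV(3) by (auto simp: f_def)
    qed
    have f_sum: "sum f W = real p * (if W = U then 1 else if W = V then -1 else 0)"
      if "W \<in> P" for W
      using that f_const cardU by simp
    have "sum f (verts G) = (\<Sum>W\<in>P. real p * (if W = U then 1 else 0))
        - (\<Sum>W\<in>P. real p * (if W = V then 1 else 0))"
      unfolding total sum_subtractf[symmetric] using f_sum UV by (intro sum.cong) auto
    then have sum0: "sum f (verts G) = 0"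
      using UV finP(1) by (simp flip: sum_distrib_left)
    have "c * (sum f (verts G) - sum f W) = - (real p * c) * f w" if "W \<in> P" "w \<in> W" for W w
      unfolding sum0 f_sum[OF that(1)] f_const[OF that(2,1)] by simp
    moreover obtain u where u: "u \<in> U"
      using cardU[OF UV(1)] assms(2) by fastforce
    moreover have "f u \<noteq> 0" "u \<in> verts G"
      using f_const[OF u UV(1)] u UV in_verts by auto
    ultimately show ?thesis
      unfolding eig by blast
  qed
  moreover have "k \<in> {0, - (real p * c), real p * c * (real t - 1)}"
    if k: "eigenvalue (weighted_adj_mat \<phi> G vs) k" for k
  proof -
    obtain f where nz: "\<exists>u\<in>verts G. f u \<noteq> 0"
      and ev: "\<And>U u. U \<in> P \<Longrightarrow> u \<in> U \<Longrightarrow> c * (sum f (verts G) - sum f U) = k * f u"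
      using k unfolding eig by blast
    define S where "S = sum f (verts G)"
    have parts: "(k + real p * c) * sum f U = real p * c * S" if "U \<in> P" for U
    proof -
      have "k * sum f U = (\<Sum>u\<in>U. c * (S - sum f U))"
        unfolding sum_distrib_left by (rule sum.cong) (use ev that in \<open>auto simp: S_def\<close>)
      then show ?thesis
        using cardU[OF that] by (simp add: algebra_simps)
    qed
    have "k = 0 \<or> k = real p * c * (real t - 1)" if neq: "k \<noteq> - (real p * c)"
    proof -
      define s where "s = real p * c * S / (k + real p * c)"
      have "k + real p * c \<noteq> 0" using neq by linarith
      then have s: "sum f U = s" if "U \<in> P" for U
        using parts[OF that] by (simp add: s_def field_simps)
      then have S: "S = real t * s"
        by (simp add: S_def total cardP)
      obtain u U where u: "f u \<noteq> 0" "u \<in> U" "U \<in> P" using nz in_verts by blast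
      have "k * s = real p * c * (real t - 1) * s"
        using parts[OF u(3)] s[OF u(3)] S by (simp add: algebra_simps)
      moreover have "k = 0" if "s = 0"
        using ev[OF u(3,2)] u(1) s[OF u(3)] S that by (simp add: S_def)
      ultimately show ?thesis by auto
    qed
    then show ?thesis by blast
  qed
  ultimately show ?thesis
    unfolding c_def[symmetric] by (metis Ints_0 Ints_1 Ints_diff Ints_minus Ints_mult Ints_of_nat
      empty_iff insert_iff minus_minus)
qed

end
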